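(* If the set of colors $C$ has a group structure, then for every $n$ the homogeneous component $\mathbf{Sym}^{(l)}_n$ of degree $n$ becomes a subalgebra of the group algebra $\mathbb C[C\wr\mathfrak S_n]$ under the identification $\mathbf G_h\mapsto h$, for $h=(\sigma,u)\in\mathfrak S_n\times C^n$; that is, the image of $\mathbf{Sym}_n^{(l)}$ under this linear map is a subalgebra of $\mathbb C[C\wr\mathfrak S_n]$.
   Context: Here $\mathbb N=\{0,1,2,\dots\}$. Let $l\ge1$ and let $C=\{c_0,\dots,c_{l-1}\}$ be a set of $l$ colors. A colored permutation of size $n\ge0$ is a pair $(\sigma,u)$ with $\sigma\in\mathfrak S_n$, $u\in C^n$ (permutations are written as words; color words are indexed by positions). Let $\mathbf{FQSym}^{(l)}$ be the graded algebra over $\mathbb C$ with basis $(\mathbf G_{\sigma,u})$ indexed by all colored permutations (degree = size), with product $$\mathbf G_{\sigma',u'}\mathbf G_{\sigma'',u''}=\sum_{\sigma\in\sigma'*\sigma''}\mathbf G_{\sigma,u'\cdot u''},$$ where $u'\cdot u''$ is concatenation and $\sigma'*\sigma''$ is the set of permutations $\tau$ of size $|\sigma'|+|\sigma''|$ whose first $|\sigma'|$ letters standardize to $\sigma'$ and whose remaining letters standardize to $\sigma''$ (the standardization of a word with distinct integer letters is the permutation whose letters are in the same relative order). For $\mathbf n=(n_0,\dots,n_{l-1})\in\mathbb N^l$ with $|\mathbf n|=\sum_i n_i=n$, put $S_{\mathbf n}=\sum_{u}\mathbf G_{12\cdots n,u}$, the sum over all $u\in C^n$ having exactly $n_i$ occurrences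 of the color $c_i$ for each $i$ (and $S_{\mathbf 0}=1$). $\mathbf{Sym}^{(l)}$ is the subalgebra of $\mathbf{FQSym}^{(l)}$ generated by the $S_{\mathbf n}$, and $\mathbf{Sym}^{(l)}_n$ is its degree $n$ component. When $C$ is a group, the wreath product $C\wr\mathfrak S_n=\mathfrak S_n\ltimes C^n$ is the set of colored permutations of size $n$ with multiplication $$(\sigma;c_1,\dots,c_n)\cdot(\tau;d_1,\dots,d_n)=(\sigma\tau;\,c_{\tau(1)}d_1,\dots,c_{\tau(n)}d_n),$$ where here $c_i,d_i$ denote elements of $C$ and $(\sigma\tau)(i)=\sigma(\tau(i))$. *)

theory Defs
  imports
    Complex_Main
    "HOL-Library.Poly_Mapping"
    "HOL-Algebra.Module"
    "HOL-Algebra.Subrings"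
    "HOL-Combinatorics.Multiset_Permutations"
begin

definition complex_ring :: "complex ring" where
  "complex_ring = \<lparr>carrier = UNIV, monoid.mult = (*), one = 1, zero = 0, add = (+)\<rparr>"

text \<open>Subalgebras are complex-linear, closed under multiplication, and contain the unit.\<close>

definition complex_subalgebra :: "'a set \<Rightarrow> (complex, 'a) module \<Rightarrow> bool" where
  "complex_subalgebra V A \<longleftrightarrow> subring V A \<and> submodule V complex_ring A"

definition scale :: "complex \<Rightarrow> ('h \<Rightarrow>\<^sub>0 complex) \<Rightarrow> ('h \<Rightarrow>\<^sub>0 complex)" where
  "scale a f = Poly_Mapping.map ((*) a) f"

abbreviation basis_elt :: "'h \<Rightarrow> ('h \<Rightarrow>\<^sub>0 complex)" where
  "basis_elt h \<equiv> Poly_Mapping.single h 1"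

text \<open>
  The complex algebra with basis indexed by \<open>B\<close>: the product is the bilinear extension of the
  product \<open>m x y\<close> of the basis elements \<open>x\<close> and \<open>y\<close>, and the unit is the basis element \<open>e\<close>.
\<close>

definition algebra_with_basis ::
    "'h set \<Rightarrow> ('h \<Rightarrow> 'h \<Rightarrow> ('h \<Rightarrow>\<^sub>0 complex)) \<Rightarrow> 'h \<Rightarrow> (complex, 'h \<Rightarrow>\<^sub>0 complex) module" where
  "algebra_with_basis B m e =
    \<lparr>carrier = {f. Poly_Mapping.keys f \<subseteq> B},
     monoid.mult = (\<lambda>f g. \<Sum>x\<in>Poly_Mapping.keys f. \<Sum>y\<in>Poly_Mapping.keys g.
               scale (Poly_Mapping.lookup f x * Poly_Mapping.lookup g y) (m x y)),
     one = basis_elt e,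
     zero = 0,
     add = (+),
     smult = scale\<rparr>"

definition group_algebra :: "('h, 'b) monoid_scheme \<Rightarrow> (complex, 'h \<Rightarrow>\<^sub>0 complex) module" where
  "group_algebra H =
    algebra_with_basis (carrier H) (\<lambda>x y. basis_elt (x \<otimes>\<^bsub>H\<^esub> y)) \<one>\<^bsub>H\<^esub>"

text \<open>Permutations of size \<open>n\<close> are words, i.e. lists, in the letters \<open>1, \<dots>, n\<close>.\<close>

type_synonym 'c colored_perm = "nat list \<times> 'c list"

definition colored_perms_of_size :: "'c set \<Rightarrow> nat \<Rightarrow> 'c colored_perm set" where
  "colored_perms_of_size C n =
    permutations_of_set {1..n} \<times> {u. set u \<subseteq> C \<and> length u = n}"

definition colored_perms :: "'c set \<Rightarrow> 'c colored_perm set" where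
  "colored_perms C = (\<Union>n. colored_perms_of_size C n)"

definition std :: "nat list \<Rightarrow> nat list" where
  "std w = map (\<lambda>x. card {y \<in> set w. y \<le> x}) w"

definition convolution :: "nat list \<Rightarrow> nat list \<Rightarrow> nat list set" where
  "convolution \<sigma>' \<sigma>'' =
    {\<tau> \<in> permutations_of_set {1..length \<sigma>' + length \<sigma>''}.
       std (take (length \<sigma>') \<tau>) = \<sigma>' \<and> std (drop (length \<sigma>') \<tau>) = \<sigma>''}"

definition FQSym :: "'c set \<Rightarrow> (complex, 'c colored_perm \<Rightarrow>\<^sub>0 complex) module" where
  "FQSym C =
    algebra_with_basis (colored_perms C)
      (\<lambda>(\<sigma>', u') (\<sigma>'', u''). \<Sum>\<sigma>\<in>convolution \<sigma>' \<sigma>''. basis_elt (\<sigma>, u' @ u''))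
      ([], [])"

text \<open>
  The colors are \<open>c 0, \<dots>, c (l - 1)\<close>. A vector in \<open>\<nat>\<^sup>l\<close> is given by a function on the
  natural numbers, of which only the values at arguments below \<open>l\<close> matter.
\<close>

definition S_gen :: "nat \<Rightarrow> (nat \<Rightarrow> 'c) \<Rightarrow> (nat \<Rightarrow> nat) \<Rightarrow> ('c colored_perm \<Rightarrow>\<^sub>0 complex)" where
  "S_gen l c \<nn> =
    (\<Sum>u\<in>{u. set u \<subseteq> c ` {..<l} \<and> length u = (\<Sum>i<l. \<nn> i) \<and>
              (\<forall>i<l. count_list u (c i) = \<nn> i)}.
       basis_elt ([1..<Suc (\<Sum>i<l. \<nn> i)], u))"

definition Sym :: "nat \<Rightarrow> (nat \<Rightarrow> 'c) \<Rightarrow> ('c colored_perm \<Rightarrow>\<^sub>0 complex) set" where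
  "Sym l c =
    \<Inter>{V. complex_subalgebra V (FQSym (c ` {..<l})) \<and> (\<forall>\<nn>. S_gen l c \<nn> \<in> V)}"

definition Sym_component ::
    "nat \<Rightarrow> (nat \<Rightarrow> 'c) \<Rightarrow> nat \<Rightarrow> ('c colored_perm \<Rightarrow>\<^sub>0 complex) set" where
  "Sym_component l c n =
    {f \<in> Sym l c. Poly_Mapping.keys f \<subseteq> colored_perms_of_size (c ` {..<l}) n}"

text \<open>Letters start at \<open>1\<close> and list positions at \<open>0\<close>, whence the shifts by one.\<close>

definition wreath :: "('c, 'b) monoid_scheme \<Rightarrow> nat \<Rightarrow> 'c colored_perm monoid" where
  "wreath G n =
    \<lparr>carrier = colored_perms_of_size (carrier G) n,
     monoid.mult = (\<lambda>(\<sigma>, c) (\<tau>, d).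
       (map (\<lambda>j. \<sigma> ! (j - 1)) \<tau>, map2 (\<lambda>j x. c ! (j - 1) \<otimes>\<^bsub>G\<^esub> x) \<tau> d)),
     one = ([1..<Suc n], replicate n \<one>\<^bsub>G\<^esub>)\<rparr>"

text \<open>
  The linear extension of \<open>\<^bold>G\<^sub>h \<mapsto> h\<close>. Both bases are indexed by colored permutations and both
  algebras consist of finitely supported functions on them, so on elements this is the identity.
\<close>

definition to_group_algebra ::
    "('c colored_perm \<Rightarrow>\<^sub>0 complex) \<Rightarrow> ('c colored_perm \<Rightarrow>\<^sub>0 complex)" where
  "to_group_algebra f =
    (\<Sum>h\<in>Poly_Mapping.keys f. scale (Poly_Mapping.lookup f h) (basis_elt h))"

end

theory Submission
  imports Defs
begin

text \<open>
  The degree \<open>n\<close> component is spanned by the products \<open>S\<^sub>\<nn>\<^sub>1 \<cdots> S\<^sub>\<nn>\<^sub>k\<close> of total degree \<open>n\<close>. Such a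
  product is the sum of all \<open>(\<sigma>, u)\<close> with \<open>\<sigma>\<close> increasing on consecutive blocks and \<open>u\<close> having
  prescribed color content on each block. Reading block labels and colors along \<open>\<sigma>\<^sup>-\<^sup>1\<close> identifies
  these \<open>(\<sigma>, u)\<close> with the rearrangements of a multiset of pairs (label, color), and \<open>\<sigma>\<close> is
  recovered by stable sorting of the labels. Since sorting stably twice is sorting by the
  lexicographic key, multiplication in the wreath product turns a pair of words into the word of
  pairs, with labels refined and colors multiplied. The product of two spanning elements is thus a
  sum over the words of pairs with given marginals. Each word is hit with a multiplicity that depends
  only on its multiset of letters, so the product is again a combination of spanning elements.
\<close>

subsection \<open>Algebras given by a basis\<close>

lemma lookup_scale [simp]: "Poly_Mapping.lookup (scale a f) k = a * Poly_Mapping.lookup f k"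
  by (auto simp: scale_def Poly_Mapping.map.rep_eq when_def)

interpretation scale: vector_space scale
  by unfold_locales (auto intro!: poly_mapping_eqI simp: lookup_add algebra_simps)

lemma scale_basis_elt: "scale a (basis_elt h) = Poly_Mapping.single h a"
  by (auto intro!: poly_mapping_eqI simp: lookup_single when_def)

lemma sum_single_lookup:
  "(\<Sum>h\<in>Poly_Mapping.keys f. Poly_Mapping.single h (Poly_Mapping.lookup f h)) = f"
  by (auto intro!: poly_mapping_eqI simp: lookup_sum lookup_single when_def in_keys_iff)

lemma to_group_algebra_eq: "to_group_algebra f = f"
  by (simp add: to_group_algebra_def scale_basis_elt sum_single_lookup)

lemma subspace_keys: "scale.subspace {f. Poly_Mapping.keys f \<subseteq> B}"
  by (auto simp: scale.subspace_def in_keys_iff lookup_add subset_iff) (metis add.left_neutral)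

text \<open>The product of \<open>algebra_with_basis\<close> with the structure constants
  \<open>m\<close> left open, so that the same facts serve both \<open>FQSym\<close> and the group
  algebra.\<close>

definition bilin :: "('h \<Rightarrow> 'h \<Rightarrow> ('h \<Rightarrow>\<^sub>0 complex)) \<Rightarrow> ('h \<Rightarrow>\<^sub>0 complex) \<Rightarrow> ('h \<Rightarrow>\<^sub>0 complex)
    \<Rightarrow> ('h \<Rightarrow>\<^sub>0 complex)" where
  "bilin m f g = (\<Sum>x\<in>Poly_Mapping.keys f. \<Sum>y\<in>Poly_Mapping.keys g.
     scale (Poly_Mapping.lookup f x * Poly_Mapping.lookup g y) (m x y))"

text \<open>Terms outside the supports vanish. Summing over fixed finite ranges lets sums such as
  \<open>f + f'\<close>, whose support may shrink by cancellation, be compared termwise.\<close>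

lemma bilin_superset:
  assumes "finite X" "finite Y" "Poly_Mapping.keys f \<subseteq> X" "Poly_Mapping.keys g \<subseteq> Y"
  shows "bilin m f g = (\<Sum>x\<in>X. \<Sum>y\<in>Y.
    scale (Poly_Mapping.lookup f x * Poly_Mapping.lookup g y) (m x y))"
proof -
  have "bilin m f g = (\<Sum>x\<in>Poly_Mapping.keys f. \<Sum>y\<in>Y.
    scale (Poly_Mapping.lookup f x * Poly_Mapping.lookup g y) (m x y))"
    unfolding bilin_def using assms
    by (intro sum.cong refl sum.mono_neutral_left) (auto simp: in_keys_iff)
  also have "\<dots> = (\<Sum>x\<in>X. \<Sum>y\<in>Y.
    scale (Poly_Mapping.lookup f x * Poly_Mapping.lookup g y) (m x y))"
    using assms by (intro sum.mono_neutral_left) (auto simp: in_keys_iff)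
  finally show ?thesis .
qed

lemma bilin_add_left: "bilin m (f + f') g = bilin m f g + bilin m f' g"
proof -
  let ?X = "Poly_Mapping.keys f \<union> Poly_Mapping.keys f'" and ?Y = "Poly_Mapping.keys g"
  have *: "finite ?X" "finite ?Y" by auto
  have "Poly_Mapping.keys (f + f') \<subseteq> ?X" by (rule keys_add)
  then show ?thesis
    by (simp add: bilin_superset[OF *] lookup_add ring_distribs scale.scale_left_distrib
        sum.distrib)
qed

lemma bilin_add_right: "bilin m f (g + g') = bilin m f g + bilin m f g'"
proof -
  let ?X = "Poly_Mapping.keys f" and ?Y = "Poly_Mapping.keys g \<union> Poly_Mapping.keys g'"
  have *: "finite ?X" "finite ?Y" by auto
  have "Poly_Mapping.keys (g + g') \<subseteq> ?Y" by (rule keys_add)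
  then show ?thesis
    by (simp add: bilin_superset[OF *] lookup_add ring_distribs scale.scale_left_distrib
        sum.distrib)
qed

lemma keys_scale: "Poly_Mapping.keys (scale a f) \<subseteq> Poly_Mapping.keys f"
  by (auto simp: in_keys_iff)

lemma bilin_scale_left: "bilin m (scale a f) g = scale a (bilin m f g)"
  by (subst bilin_superset[of "Poly_Mapping.keys f" "Poly_Mapping.keys g"])
    (auto simp: keys_scale[THEN subsetD] bilin_def scale.scale_sum_right mult.assoc)

lemma bilin_scale_right: "bilin m f (scale a g) = scale a (bilin m f g)"
  by (subst bilin_superset[of "Poly_Mapping.keys f" "Poly_Mapping.keys g"])
    (auto simp: keys_scale[THEN subsetD] bilin_def scale.scale_sum_right mult.left_commute)

lemma bilin_zero_left [simp]: "bilin m 0 g = 0"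
  by (simp add: bilin_def)

lemma bilin_zero_right [simp]: "bilin m f 0 = 0"
  by (simp add: bilin_def)

lemma bilin_sum_left: "bilin m (\<Sum>i\<in>I. f i) g = (\<Sum>i\<in>I. bilin m (f i) g)"
  by (induction I rule: infinite_finite_induct) (auto simp: bilin_add_left)

lemma bilin_sum_right: "bilin m f (\<Sum>i\<in>I. g i) = (\<Sum>i\<in>I. bilin m f (g i))"
  by (induction I rule: infinite_finite_induct) (auto simp: bilin_add_right)

lemma bilin_basis_elt [simp]: "bilin m (basis_elt x) (basis_elt y) = m x y"
  by (simp add: bilin_def)

lemma bilin_sum_basis_elt:
  "bilin m (\<Sum>x\<in>X. basis_elt x) (\<Sum>y\<in>Y. basis_elt y) = (\<Sum>x\<in>X. \<Sum>y\<in>Y. m x y)"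
  by (simp add: bilin_sum_left bilin_sum_right[where f = "basis_elt _"])

text \<open>One span induction per argument: with the other argument fixed, the elements whose
  product lies in \<open>W\<close> form a subspace. Closure thus needs checking on generators
  only.\<close>

lemma bilin_span:
  assumes W: "scale.subspace W" and gen: "\<And>f g. f \<in> X \<Longrightarrow> g \<in> X \<Longrightarrow> bilin m f g \<in> W"
    and f: "f \<in> scale.span X" and g: "g \<in> scale.span X"
  shows "bilin m f g \<in> W"
proof -
  have right: "bilin m h g \<in> W" if "h \<in> X" for h
  proof (rule scale.span_induct[OF g, of "\<lambda>g. bilin m h g \<in> W"])
    show "scale.subspace {g. bilin m h g \<in> W}"
      using W by (auto simp: scale.subspace_def bilin_add_right bilin_scale_right)
  qed (use gen that in auto)
  show ?thesis
  proof (rule scale.span_induct[OF f, of "\<lambda>f. bilin m f g \<in> W"])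
    show "scale.subspace {f. bilin m f g \<in> W}"
      using W by (auto simp: scale.subspace_def bilin_add_left bilin_scale_left)
  qed (use right in auto)
qed

text \<open>Reduces the algebraic structure predicates to linear algebra over \<open>scale\<close>
  and closure under \<open>bilin\<close>, for arbitrary structure constants.\<close>

lemma complex_subalgebra_iff:
  "complex_subalgebra V (algebra_with_basis B m e) \<longleftrightarrow>
    scale.subspace V \<and> V \<subseteq> {f. Poly_Mapping.keys f \<subseteq> B} \<and> basis_elt e \<in> V \<and>
    (\<forall>f\<in>V. \<forall>g\<in>V. bilin m f g \<in> V)"
    (is "?L \<longleftrightarrow> ?R")
proof
  let ?A = "algebra_with_basis B m e"
  assume L: ?L
  then have *: "subgroup V (add_monoid ?A)" "submonoid V ?A" "submodule V complex_ring ?A"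
    by (simp_all add: complex_subalgebra_def subring_def)
  have "scale.subspace V"
    using subgroup.m_closed[OF *(1)] subgroup.one_closed[OF *(1)] submodule.smult_closed[OF *(3)]
    by (simp add: scale.subspace_def algebra_with_basis_def complex_ring_def)
  moreover have "V \<subseteq> {f. Poly_Mapping.keys f \<subseteq> B}"
    using subgroup.subset[OF *(1)] by (simp add: algebra_with_basis_def)
  moreover have "basis_elt e \<in> V" "\<forall>f\<in>V. \<forall>g\<in>V. bilin m f g \<in> V"
    using submonoid.one_closed[OF *(2)] submonoid.m_closed[OF *(2)]
    by (simp_all add: algebra_with_basis_def bilin_def)
  ultimately show ?R by blast
next
  let ?A = "algebra_with_basis B m e"
  assume R: ?R
  \<comment> \<open>The inverse in the additive monoid is a definite description over the carrier;
    it has to be identified with \<open>- f\<close> before closure of the subspace under negation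
    applies.\<close>
  have inv: "inv\<^bsub>add_monoid ?A\<^esub> f = - f" if "f \<in> V" for f
    unfolding m_inv_def using R that
    by (intro the_equality)
     (auto simp: algebra_with_basis_def eq_neg_iff_add_eq_0 add.commute)
  have sub: "subgroup V (add_monoid ?A)"
  proof
    fix f assume "f \<in> V"
    then show "inv\<^bsub>add_monoid ?A\<^esub> f \<in> V"
      using R inv scale.subspace_neg by metis
  qed (use R in \<open>auto simp: algebra_with_basis_def scale.subspace_def\<close>)
  moreover have "submonoid V ?A"
    using R by unfold_locales (auto simp: algebra_with_basis_def bilin_def)
  moreover have "submodule_axioms V complex_ring ?A"
    using R by unfold_locales (auto simp: algebra_with_basis_def scale.subspace_def)
  ultimately show ?L
    by (simp add: complex_subalgebra_def subring_def submodule_def)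
qed

subsection \<open>Products of generators\<close>

text \<open>
  A product \<open>S\<^sub>\<nn>\<^sub>1 \<cdots> S\<^sub>\<nn>\<^sub>k\<close> is encoded by the multiset of pairs \<open>(i, x)\<close>, one for each
  occurrence of the color \<open>x\<close> in the \<open>i\<close>-th factor. The labels in increasing order give the block
  to which each position belongs. Only their relative order matters, so labels may have gaps.
\<close>

definition labels :: "(nat \<times> 'c) multiset \<Rightarrow> nat list" where
  "labels M = sorted_list_of_multiset (image_mset fst M)"

definition blocked :: "(nat \<times> 'c) multiset \<Rightarrow> 'c colored_perm set" where
  "blocked M = {(\<sigma>, u). \<sigma> \<in> permutations_of_set {1..size M} \<and> length u = size M \<and>
     mset (zip (labels M) u) = M \<and>
     (\<forall>p q. p < q \<longrightarrow> q < size M \<longrightarrow> labels M ! p = labels M ! q \<longrightarrow> \<sigma> ! p < \<sigma> ! q)}"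

definition S_prod :: "(nat \<times> 'c) multiset \<Rightarrow> ('c colored_perm \<Rightarrow>\<^sub>0 complex)" where
  "S_prod M = (\<Sum>h\<in>blocked M. basis_elt h)"

lemma length_labels [simp]: "length (labels M) = size M"
  by (metis labels_def mset_sorted_list_of_multiset size_image_mset size_mset)

lemma mset_labels [simp]: "mset (labels M) = image_mset fst M"
  by (simp add: labels_def)

lemma set_labels [simp]: "set (labels M) = fst ` set_mset M"
  by (metis mset_labels set_image_mset set_mset_mset)

lemma sorted_labels [simp]: "sorted (labels M)"
  by (simp add: labels_def)

lemma labels_eqI: "sorted b \<Longrightarrow> mset b = image_mset fst M \<Longrightarrow> labels M = b"
  by (metis labels_def sorted_list_of_multiset_mset sorted_sort_id)

lemma permutations_of_set_length: "\<sigma> \<in> permutations_of_set {1..n} \<Longrightarrow> length \<sigma> = n"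
  by (simp add: length_finite_permutations_of_set)

lemma blockedD:
  assumes "(\<sigma>, u) \<in> blocked M"
  shows "\<sigma> \<in> permutations_of_set {1..size M}" "length \<sigma> = size M" "length u = size M"
    "mset (zip (labels M) u) = M"
    "\<And>p q. p < q \<Longrightarrow> q < size M \<Longrightarrow> labels M ! p = labels M ! q \<Longrightarrow> \<sigma> ! p < \<sigma> ! q"
  using assms by (auto simp: blocked_def permutations_of_set_length)

lemma blocked_mset_snd:
  assumes "(\<sigma>, u) \<in> blocked M"
  shows "mset u = image_mset snd M"
proof -
  have "image_mset snd (mset (zip (labels M) u)) = mset u"
    using blockedD(3)[OF assms] by (simp flip: mset_map)
  then show ?thesis using blockedD(4)[OF assms] by simp
qed

lemma finite_blocked [simp]: "finite (blocked M)"
proof (rule finite_subset)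
  show "blocked M \<subseteq> permutations_of_set {1..size M} \<times> permutations_of_multiset (image_mset snd M)"
    using blockedD(1) blocked_mset_snd by (fastforce simp: permutations_of_multiset_def)
qed auto

lemma blocked_subset:
  assumes "snd ` set_mset M \<subseteq> C"
  shows "blocked M \<subseteq> colored_perms_of_size C (size M)"
proof clarify
  fix \<sigma> u assume h: "(\<sigma>, u) \<in> blocked M"
  have "set u = snd ` set_mset M"
    using blocked_mset_snd[OF h] by (metis set_image_mset set_mset_mset)
  then show "(\<sigma>, u) \<in> colored_perms_of_size C (size M)"
    using blockedD[OF h] assms by (auto simp: colored_perms_of_size_def)
qed

text \<open>Labels enter \<open>blocked\<close> only through their sorted order and their
  equalities, and a strictly increasing map preserves both. This allows the labels of two factors to
  be moved apart.\<close>

lemma blocked_relabel: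
  fixes M :: "(nat \<times> 'c) multiset"
  assumes "strict_mono g"
  shows "blocked (image_mset (map_prod g id) M) = blocked M"
proof -
  let ?M = "image_mset (map_prod g id) M"
  have g: "inj g" "mono g" using assms by (simp_all add: strict_mono_imp_inj_on strict_mono_mono)
  have lab: "labels ?M = map g (labels M)"
  proof (rule labels_eqI)
    show "sorted (map g (labels M))"
      using g by (simp add: sorted_map monoD sorted_wrt_mono_rel[OF _ sorted_labels])
  qed (simp add: multiset.map_comp comp_def)
  have "mset (zip (map g (labels M)) u) = image_mset (map_prod g id) (mset (zip (labels M) u))"
    for u :: "'c list"
    by (simp add: zip_map1 map_prod_def case_prod_unfold flip: mset_map)
  then have "mset (zip (map g (labels M)) u) = ?M \<longleftrightarrow> mset (zip (labels M) u) = M" for u :: "'c list"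
    by (simp add: inj_eq[OF multiset.inj_map[OF prod.inj_map[OF g(1) inj_on_id]]])
  moreover have "map g (labels M) ! p = map g (labels M) ! q \<longleftrightarrow> labels M ! p = labels M ! q"
    if "p < q" "q < size M" for p q
    using that g by (simp add: inj_eq)
  ultimately show ?thesis unfolding blocked_def lab by auto
qed

text \<open>With a single block the permutation must increase throughout, hence is the identity, and
  the colors may be arranged freely. This is the shape of one generator.\<close>

lemma blocked_single_label:
  "blocked (image_mset (Pair a) U) = {[1..<Suc (size U)]} \<times> {u. mset u = U}"
proof -
  let ?M = "image_mset (Pair a) U"
  have lab: "labels ?M = replicate (size U) a"
    by (rule labels_eqI) (auto simp: multiset.map_comp comp_def image_mset_const_eq)
  have z: "mset (zip (replicate (size U) a) u) = image_mset (Pair a) (mset u)"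
    if "length u = size U" for u
    using that by (simp add: zip_replicate1 flip: mset_map)
  have inj: "image_mset (Pair a) V = image_mset (Pair a) U \<longleftrightarrow> V = U" for V
    by (intro inj_eq multiset.inj_map) (simp add: inj_on_def)
  \<comment> \<open>A strictly increasing list is determined by its set of entries.\<close>
  have incr: "\<sigma> \<in> permutations_of_set {1..n} \<and> (\<forall>p q. p < q \<longrightarrow> q < n \<longrightarrow> \<sigma> ! p < \<sigma> ! q) \<longleftrightarrow>
      \<sigma> = [1..<Suc n]" for \<sigma> n
  proof
    assume *: "\<sigma> \<in> permutations_of_set {1..n} \<and> (\<forall>p q. p < q \<longrightarrow> q < n \<longrightarrow> \<sigma> ! p < \<sigma> ! q)"
    then have "sorted_wrt (<) \<sigma>"
      using permutations_of_set_length[of \<sigma> n] by (auto simp: sorted_wrt_iff_nth_less)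
    moreover have "sorted_wrt (<) [1..<Suc n]" by (rule sorted_wrt_upt)
    moreover have "set [1..<Suc n] = set \<sigma>" using * permutations_of_setD(1) by force
    ultimately show "\<sigma> = [1..<Suc n]" by (rule strict_sorted_equal[symmetric])
  qed (auto simp: permutations_of_set_def nth_append simp del: upt_Suc)
  have "(\<sigma>, u) \<in> blocked ?M \<longleftrightarrow> (\<sigma>, u) \<in> {[1..<Suc (size U)]} \<times> {u. mset u = U}" for \<sigma> u
  proof -
    have "(\<sigma>, u) \<in> blocked ?M \<longleftrightarrow> mset u = U \<and> (\<sigma> \<in> permutations_of_set {1..size U} \<and>
        (\<forall>p q. p < q \<longrightarrow> q < size U \<longrightarrow> \<sigma> ! p < \<sigma> ! q))"
      unfolding blocked_def lab using z[of u] inj[of "mset u"] by auto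
    then show ?thesis unfolding incr by blast
  qed
  then show ?thesis by (auto simp del: upt_Suc)
qed

text \<open>The multiset \<open>U\<close> is the color content described by the vector; the label
  \<open>a\<close> is arbitrary because there is only one block.\<close>

lemma S_gen_eq_S_prod:
  assumes "inj_on c {..<l}" "set_mset U \<subseteq> c ` {..<l}" "\<And>i. i < l \<Longrightarrow> count U (c i) = \<nn> i"
  shows "S_gen l c \<nn> = S_prod (image_mset (Pair a) U)"
proof -
  \<comment> \<open>Injectivity of \<open>c\<close> allows the total size to be summed over color
    indices instead of colors without counting a color twice.\<close>
  have sz: "size V = (\<Sum>i<l. count V (c i))" if "set_mset V \<subseteq> c ` {..<l}" for V
  proof -
    have "size V = (\<Sum>x\<in>c ` {..<l}. count V x)"
      unfolding size_multiset_overloaded_eq using that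
      by (intro sum.mono_neutral_left) (auto simp: count_eq_zero_iff)
    then show ?thesis by (simp add: sum.reindex[OF assms(1)])
  qed
  have szU: "(\<Sum>i<l. \<nn> i) = size U" using sz[OF assms(2)] assms(3) by simp
  have "{u. set u \<subseteq> c ` {..<l} \<and> length u = (\<Sum>i<l. \<nn> i) \<and> (\<forall>i<l. count_list u (c i) = \<nn> i)} =
      {u. mset u = U}" (is "?X = ?Y")
  proof (intro equalityI subsetI)
    fix u assume u: "u \<in> ?X"
    have "count (mset u) x = count U x" for x
    proof (cases "x \<in> c ` {..<l}")
      case True
      then show ?thesis using u assms(3) by (auto simp: count_mset)
    next
      case False
      then have "x \<notin># mset u" "x \<notin># U" using u assms(2) by auto
      then show ?thesis by (metis not_in_iff)
    qed
    then show "u \<in> ?Y" by (simp add: multiset_eq_iff)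
  next
    fix u assume "u \<in> ?Y"
    then show "u \<in> ?X" using assms szU by (auto simp flip: count_mset)
  qed
  then show ?thesis
    unfolding S_gen_def S_prod_def blocked_single_label szU
    by (simp add: sum.cartesian_product' del: upt_Suc)
qed

section \<open>Standardization and concatenation of block structures\<close>

lemma length_std [simp]: "length (std w) = length w"
  by (simp add: std_def)

text \<open>The rank of a letter counts the letters up to it; passing to a larger letter
  \<open>x'\<close> of \<open>w\<close> strictly enlarges the counted set, since \<open>x'\<close>
  itself is added.\<close>

lemma std_less_iff:
  assumes "p < length w" "q < length w"
  shows "std w ! p < std w ! q \<longleftrightarrow> w ! p < w ! q"
proof -
  have *: "card {y \<in> set w. y \<le> x} < card {y \<in> set w. y \<le> x'}" if "x < x'" "x' \<in> set w" for x x'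
    proof (intro psubset_card_mono psubsetI)
    show "{y \<in> set w. y \<le> x} \<noteq> {y \<in> set w. y \<le> x'}" using that leD by blast
  qed (use that in auto)
  have **: "card {y \<in> set w. y \<le> x} \<le> card {y \<in> set w. y \<le> x'}" if "x \<le> x'" for x x'
    using that by (intro card_mono) auto
  show ?thesis
    using assms *[of "w ! p" "w ! q"] **[of "w ! q" "w ! p"]
    by (cases "w ! p < w ! q") (auto simp: std_def not_less)
qed

text \<open>The ranks are distinct and lie between 1 and the length, so by cardinality they take
  every value in that range.\<close>

lemma std_permutation:
  assumes "distinct w"
  shows "std w \<in> permutations_of_set {1..length w}"
proof
  show dist: "distinct (std w)"
    using assms unfolding distinct_conv_nth length_std
    by (metis linorder_neq_iff std_less_iff)
  have sub: "set (std w) \<subseteq> {1..length w}"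
  proof
    fix k assume "k \<in> set (std w)"
    then obtain x where x: "x \<in> set w" and k: "k = card {y \<in> set w. y \<le> x}"
      by (auto simp: std_def)
    have "k \<le> card (set w)" unfolding k by (intro card_mono) auto
    moreover have "card {x} \<le> k" unfolding k using x by (intro card_mono) auto
    ultimately show "k \<in> {1..length w}" using card_length[of w] by simp
  qed
  then show "set (std w) = {1..length w}"
    using card_subset_eq[OF _ sub] distinct_card[OF dist] by simp
qed

text \<open>Cutting a word after \<open>size M\<close> letters and standardizing both halves
  recovers the factors. All labels of \<open>M\<close> being smaller, the blocks of \<open>N\<close>
  follow those of \<open>M\<close>, and \<open>blocked\<close> imposes no condition between
  different blocks; so the convolution yields exactly the words required for
  \<open>M + N\<close>.\<close>

lemma S_prod_mult:
  assumes less: "\<And>x y. x \<in># M \<Longrightarrow> y \<in># N \<Longrightarrow> fst x < fst y"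
  shows "bilin (\<lambda>(\<sigma>', u') (\<sigma>'', u''). \<Sum>\<sigma>\<in>convolution \<sigma>' \<sigma>''. basis_elt (\<sigma>, u' @ u''))
    (S_prod M) (S_prod N) = S_prod (M + N)"
proof -
  let ?m = "size M" and ?n = "size N"
  let ?j = "\<lambda>a. (snd a, snd (fst (fst a)) @ snd (snd (fst a)))"
  let ?i = "\<lambda>(\<sigma>, u). (((std (take ?m \<sigma>), take ?m u), (std (drop ?m \<sigma>), drop ?m u)), \<sigma>)"
  have lab: "labels (M + N) = labels M @ labels N"
    using less by (intro labels_eqI) (force simp: sorted_append)+
  \<comment> \<open>The two factors share no label, so filtering the multiset of pairs by the labels
    of \<open>M\<close> separates the two color contents.\<close>
  have split: "mset (zip (labels M @ labels N) (u' @ u'')) = M + N \<longleftrightarrow>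
      mset (zip (labels M) u') = M \<and> mset (zip (labels N) u'') = N"
    if "length u' = ?m" "length u'' = ?n" for u' u''
  proof
    assume *: "mset (zip (labels M @ labels N) (u' @ u'')) = M + N"
    let ?P = "\<lambda>x. fst x \<in> fst ` set_mset M" and ?Z = "\<lambda>K u. mset (zip (labels K) u)"
    have eq: "?Z M u' + ?Z N u'' = M + N" using * that by simp
    have disj: "\<not> ?P x" if "x \<in># N" for x using less that by fastforce
    have "filter_mset ?P (?Z M u') = ?Z M u'" "filter_mset ?P M = M"
      by (auto simp: filter_mset_eq_conv dest!: set_zip_leftD)
    moreover have "filter_mset ?P (?Z N u'') = {#}" "filter_mset ?P N = {#}"
      using disj by (force dest!: set_zip_leftD)+
    ultimately have "?Z M u' = M"
      using arg_cong[OF eq, of "filter_mset ?P"]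
      by (simp only: filter_union_mset add_0_right)
    then show "?Z M u' = M \<and> ?Z N u'' = N" using eq by simp
  qed (use that in simp)
  have "bilin (\<lambda>(\<sigma>', u') (\<sigma>'', u''). \<Sum>\<sigma>\<in>convolution \<sigma>' \<sigma>''. basis_elt (\<sigma>, u' @ u''))
    (S_prod M) (S_prod N) =
    (\<Sum>g\<in>blocked M. \<Sum>h\<in>blocked N. \<Sum>\<sigma>\<in>convolution (fst g) (fst h). basis_elt (\<sigma>, snd g @ snd h))"
    by (simp add: S_prod_def bilin_sum_basis_elt case_prod_unfold)
  also have "\<dots> = (\<Sum>a\<in>(SIGMA gh:blocked M \<times> blocked N. convolution (fst (fst gh)) (fst (snd gh))).
      basis_elt (?j a))"
    unfolding sum.cartesian_product case_prod_unfold
    by (subst sum.Sigma) (auto simp: convolution_def case_prod_unfold)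
  also have "\<dots> = S_prod (M + N)"
    unfolding S_prod_def
  proof (rule sum.reindex_bij_witness[where i = ?i and j = ?j])
    fix a assume "a \<in> (SIGMA gh:blocked M \<times> blocked N. convolution (fst (fst gh)) (fst (snd gh)))"
    then obtain \<sigma>' u' \<sigma>'' u'' \<sigma> where a: "a = (((\<sigma>', u'), (\<sigma>'', u'')), \<sigma>)"
      and g: "(\<sigma>', u') \<in> blocked M" and h: "(\<sigma>'', u'') \<in> blocked N"
      and \<sigma>: "\<sigma> \<in> convolution \<sigma>' \<sigma>''" by force
    have perm: "\<sigma> \<in> permutations_of_set {1..?m + ?n}" and len: "length \<sigma> = ?m + ?n"
      and std: "std (take ?m \<sigma>) = \<sigma>'" "std (drop ?m \<sigma>) = \<sigma>''"
      using \<sigma> blockedD(2)[OF g] blockedD(2)[OF h]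
      by (auto simp: convolution_def permutations_of_set_length)
    show "?i (?j a) = a"
      using a std blockedD(3)[OF g] by simp
    show "basis_elt (?j a) = basis_elt (?j a)" by simp
    have "\<sigma> ! p < \<sigma> ! q"
      if pq: "p < q" "q < ?m + ?n" and eq: "(labels M @ labels N) ! p = (labels M @ labels N) ! q" for p q
    proof -
      \<comment> \<open>Inside one half, standardization preserves comparisons; positions in
        different halves have different labels, so the third case is contradictory.\<close>
      consider "q < ?m" | "?m \<le> p" | "p < ?m" "?m \<le> q" by linarith
      then show ?thesis
      proof cases
        case 1
        then have "\<sigma>' ! p < \<sigma>' ! q"
          using pq eq by (intro blockedD(5)[OF g]) (auto simp: nth_append)
        then show ?thesis using 1 pq len std_less_iff[of p "take ?m \<sigma>" q] by (simp add: std)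
      next
        case 2
        then have "\<sigma>'' ! (p - ?m) < \<sigma>'' ! (q - ?m)"
          using pq eq by (intro blockedD(5)[OF h]) (auto simp: nth_append)
        then show ?thesis
          using 2 pq len std_less_iff[of "p - ?m" "drop ?m \<sigma>" "q - ?m"] by (simp add: std)
      next
        case 3
        then have "labels M ! p = labels N ! (q - ?m)" using eq by (simp add: nth_append)
        moreover have "labels M ! p \<in> fst ` set_mset M" "labels N ! (q - ?m) \<in> fst ` set_mset N"
          using 3 pq by (simp_all flip: set_labels)
        ultimately show ?thesis using less by fastforce
      qed
    qed
    then show "?j a \<in> blocked (M + N)"
      using a perm blockedD(3,4)[OF g] blockedD(3,4)[OF h]
      by (simp add: blocked_def lab)
  next
    fix b assume b: "b \<in> blocked (M + N)"
    then obtain \<sigma> u where bb: "b = (\<sigma>, u)" and h: "(\<sigma>, u) \<in> blocked (M + N)"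
      by (cases b) auto
    note D = blockedD[OF h, unfolded lab]
    show "?j (?i b) = b" by (simp add: bb)
    have zips: "mset (zip (labels M) (take ?m u)) = M \<and> mset (zip (labels N) (drop ?m u)) = N"
      using split[of "take ?m u" "drop ?m u"] D by simp
    have dist: "distinct \<sigma>" using D(1) by (simp add: permutations_of_set_def)
    have p1: "std (take ?m \<sigma>) \<in> permutations_of_set {1..?m}"
      using std_permutation[of "take ?m \<sigma>"] dist D(2) by simp
    have p2: "std (drop ?m \<sigma>) \<in> permutations_of_set {1..?n}"
      using std_permutation[of "drop ?m \<sigma>"] dist D(2) by simp
    have "(std (take ?m \<sigma>), take ?m u) \<in> blocked M"
      using p1 zips D(2,3) D(5) by (auto simp: blocked_def std_less_iff nth_append)
    moreover have "(std (drop ?m \<sigma>), drop ?m u) \<in> blocked N"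
    proof -
      have "std (drop ?m \<sigma>) ! p < std (drop ?m \<sigma>) ! q"
        if "p < q" "q < ?n" "labels N ! p = labels N ! q" for p q
        using that D(2) D(5)[of "?m + p" "?m + q"] by (simp add: std_less_iff nth_append)
      then show ?thesis using p2 zips D(2,3) by (auto simp: blocked_def)
    qed
    moreover have "\<sigma> \<in> convolution (std (take ?m \<sigma>)) (std (drop ?m \<sigma>))"
      using D(1,2) by (simp add: convolution_def)
    ultimately show "?i b \<in> (SIGMA gh:blocked M \<times> blocked N. convolution (fst (fst gh)) (fst (snd gh)))"
      by (simp add: bb)
  qed
  finally show ?thesis .
qed

subsection \<open>Rearrangements and stable sorting\<close>

text \<open>
  Indexing the terms of \<open>S_prod M\<close> by the rearrangements \<open>v\<close> of \<open>M\<close>: the letter of \<open>v\<close> at a value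
  \<open>x\<close> is the block label and the color found at the position of \<open>x\<close> in the permutation.
\<close>

definition sorting :: "(nat \<times> 'c) list \<Rightarrow> nat list" where
  "sorting v = sort_key (\<lambda>x. fst (v ! (x - 1))) [1..<Suc (length v)]"

definition unshuffle :: "(nat \<times> 'c) list \<Rightarrow> 'c colored_perm" where
  "unshuffle v = (sorting v, map (\<lambda>x. snd (v ! (x - 1))) (sorting v))"

text \<open>The order realized by stable sorting: ties between labels are broken by the values
  themselves, which makes it a strict total order.\<close>

abbreviation precedes :: "(nat \<times> 'c) list \<Rightarrow> nat \<Rightarrow> nat \<Rightarrow> bool" where
  "precedes v x y \<equiv> fst (v ! (x - 1)) < fst (v ! (y - 1)) \<or>
     fst (v ! (x - 1)) = fst (v ! (y - 1)) \<and> x < y"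

text \<open>The induction step for stability: \<open>insort_key\<close> puts \<open>x\<close> in
  front of entries with equal key, which is right because \<open>x\<close> is smaller than all of
  them.\<close>

lemma sorted_wrt_insort_key:
  fixes f :: "'a::linorder \<Rightarrow> 'b::linorder"
  assumes "sorted_wrt (\<lambda>x y. f x < f y \<or> f x = f y \<and> x < y) ys" "\<And>y. y \<in> set ys \<Longrightarrow> x < y"
  shows "sorted_wrt (\<lambda>x y. f x < f y \<or> f x = f y \<and> x < y) (insort_key f x ys)"
  using assms by (induction ys) (auto simp: set_insort_key)

lemma sorted_wrt_sort_key:
  fixes f :: "'a::linorder \<Rightarrow> 'b::linorder"
  assumes "sorted_wrt (<) xs"
  shows "sorted_wrt (\<lambda>x y. f x < f y \<or> f x = f y \<and> x < y) (sort_key f xs)"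
  using assms by (induction xs) (auto intro!: sorted_wrt_insort_key)

text \<open>If the heads differed, each would occur in the tail of the other list, so each would be
  related to the other, against asymmetry.\<close>

lemma sorted_wrt_asym_unique:
  assumes "sorted_wrt R xs" "sorted_wrt R ys" "mset xs = mset ys"
    and "\<And>x y. R x y \<Longrightarrow> \<not> R y x"
  shows "xs = ys"
  using assms(1-3)
proof (induction xs arbitrary: ys)
  case (Cons x xs)
  then obtain y ys' where ys: "ys = y # ys'" by (cases ys) auto
  have "x = y"
  proof (rule ccontr)
    assume "x \<noteq> y"
    moreover have "set (x # xs) = set (y # ys')" using Cons.prems(3) ys by (metis mset_eq_setD)
    ultimately have "y \<in> set xs" "x \<in> set ys'" by auto
    then show False using Cons.prems(1,2) ys assms(4) by auto
  qed
  then show ?case using Cons ys by auto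
qed simp

text \<open>Replaces the sorting algorithm by a characterization, so that a permutation obtained in
  another way can be recognized as \<open>sorting v\<close>.\<close>

lemma sorting_iff:
  "\<sigma> = sorting v \<longleftrightarrow> \<sigma> \<in> permutations_of_set {1..length v} \<and> sorted_wrt (precedes v) \<sigma>"
proof -
  have 1: "sorted_wrt (precedes v) (sorting v)"
    unfolding sorting_def by (rule sorted_wrt_sort_key) (rule sorted_wrt_upt)
  have 2: "sorting v \<in> permutations_of_set {1..length v}"
    by (auto simp: sorting_def permutations_of_set_def)
  have "\<sigma> = sorting v" if "\<sigma> \<in> permutations_of_set {1..length v}" "sorted_wrt (precedes v) \<sigma>"
  proof (rule sorted_wrt_asym_unique[OF that(2) 1])
    show "mset \<sigma> = mset (sorting v)"
      using permutations_of_setD[OF that(1)] permutations_of_setD[OF 2]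
      by (metis set_eq_iff_mset_eq_distinct)
  qed auto
  then show ?thesis using 1 2 by blast
qed

lemma sorting_permutation: "sorting v \<in> permutations_of_set {1..length v}"
  using sorting_iff by blast

lemma length_sorting [simp]: "length (sorting v) = length v"
  using sorting_permutation permutations_of_set_length by blast

section \<open>Reading words along permutations\<close>

lemma permutation_nth_bounds:
  assumes "\<sigma> \<in> permutations_of_set {1..n}" "p < n"
  shows "1 \<le> \<sigma> ! p" "\<sigma> ! p \<le> n" "\<sigma> ! p - 1 < n"
proof -
  have "\<sigma> ! p \<in> {1..n}"
    using assms permutations_of_set_length permutations_of_setD(1) by (metis nth_mem)
  then show "1 \<le> \<sigma> ! p" "\<sigma> ! p \<le> n" "\<sigma> ! p - 1 < n" by auto
qed

lemma mset_reindex: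
  assumes "\<sigma> \<in> permutations_of_set {1..length v}"
  shows "mset (map (\<lambda>x. v ! (x - 1)) \<sigma>) = mset v"
proof -
  have "set \<sigma> = set [1..<Suc (length v)]"
    by (simp only: set_upt atLeastLessThanSuc_atLeastAtMost permutations_of_setD(1)[OF assms])
  then have "mset \<sigma> = mset [1..<Suc (length v)]"
    using permutations_of_setD(2)[OF assms] by (metis distinct_upt set_eq_iff_mset_eq_distinct)
  then have "mset (map (\<lambda>x. v ! (x - 1)) \<sigma>) = mset (map (\<lambda>x. v ! (x - 1)) [1..<Suc (length v)])"
    by (simp only: mset_map)
  also have "map (\<lambda>x. v ! (x - 1)) [1..<Suc (length v)] = v"
    by (rule nth_equalityI) (auto simp del: upt_Suc)
  finally show ?thesis .
qed

lemma reindex_inj: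
  assumes \<sigma>: "\<sigma> \<in> permutations_of_set {1..n}" and len: "length v = n" "length w = n"
    and eq: "map (\<lambda>x. v ! (x - 1)) \<sigma> = map (\<lambda>x. w ! (x - 1)) \<sigma>"
  shows "v = w"
proof (rule nth_equalityI)
  fix i assume "i < length v"
  then have "Suc i \<in> set \<sigma>" using \<sigma> len permutations_of_setD(1) by fastforce
  then show "v ! i = w ! i" using eq by (metis diff_Suc_1 map_eq_conv)
qed (simp add: len)

lemma labels_sorting: "map (\<lambda>x. fst (v ! (x - 1))) (sorting v) = labels (mset v)"
proof (rule labels_eqI[symmetric])
  show "sorted (map (\<lambda>x. fst (v ! (x - 1))) (sorting v))"
    by (simp add: sorting_def)
  have "map (\<lambda>x. fst (v ! (x - 1))) (sorting v) = map fst (map (\<lambda>x. v ! (x - 1)) (sorting v))"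
    by simp
  then show "mset (map (\<lambda>x. fst (v ! (x - 1))) (sorting v)) = image_mset fst (mset v)"
    by (simp only: mset_map[of fst] mset_reindex[OF sorting_permutation])
qed

lemma zip_labels_unshuffle:
  "zip (labels (mset v)) (snd (unshuffle v)) = map (\<lambda>x. v ! (x - 1)) (sorting v)"
  by (simp add: unshuffle_def zip_map_map zip_same_conv_map comp_def flip: labels_sorting)

lemma unshuffle_in_blocked: "unshuffle v \<in> blocked (mset v)"
proof -
  have "sorting v ! p < sorting v ! q"
    if "p < q" "q < length v" "labels (mset v) ! p = labels (mset v) ! q" for p q
  proof -
    have "precedes v (sorting v ! p) (sorting v ! q)"
      using sorting_iff[of "sorting v" v] that by (auto simp: sorted_wrt_iff_nth_less)
    then show ?thesis using that by (simp flip: labels_sorting)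
  qed
  moreover have "mset (zip (labels (mset v)) (snd (unshuffle v))) = mset v"
    using zip_labels_unshuffle mset_reindex[OF sorting_permutation] by metis
  ultimately show ?thesis
    using sorting_permutation[of v] by (auto simp: blocked_def unshuffle_def)
qed

text \<open>Injectivity: the image determines \<open>sorting v\<close> and the word \<open>v\<close>
  read along it, hence \<open>v\<close>. Surjectivity: write the label and color of position
  \<open>p\<close> at the value that the permutation has there; sorted labels and increase within
  blocks make the permutation the stable sorting of the resulting word.\<close>

lemma bij_betw_unshuffle: "bij_betw unshuffle (permutations_of_multiset M) (blocked M)"
proof (rule bij_betwI')
  fix v w assume vw: "v \<in> permutations_of_multiset M" "w \<in> permutations_of_multiset M"
  then have m: "mset v = M" "mset w = M" by (auto dest: permutations_of_multisetD)
  show "unshuffle v = unshuffle w \<longleftrightarrow> v = w"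
  proof
    assume eq: "unshuffle v = unshuffle w"
    then have s: "sorting v = sorting w" by (simp add: unshuffle_def)
    have "map (\<lambda>x. v ! (x - 1)) (sorting v) = map (\<lambda>x. w ! (x - 1)) (sorting w)"
      using zip_labels_unshuffle[of v] zip_labels_unshuffle[of w] eq m by simp
    moreover have "length w = length v" using m by (metis size_mset)
    ultimately show "v = w" using reindex_inj[OF sorting_permutation[of v] refl] s by metis
  qed simp
next
  fix v assume "v \<in> permutations_of_multiset M"
  then show "unshuffle v \<in> blocked M"
    using unshuffle_in_blocked permutations_of_multisetD by blast
next
  fix h assume "h \<in> blocked M"
  then obtain \<sigma> u where h: "h = (\<sigma>, u)" and su: "(\<sigma>, u) \<in> blocked M"
    by (cases h) auto
  note D = blockedD[OF su]
  let ?n = "size M"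
  have dist: "distinct \<sigma>" using D(1) by (rule permutations_of_setD)
  \<comment> \<open>The lookup in the zipped list plays the role of the inverse permutation: the
    entry for the value \<open>x\<close> sits at index \<open>x - 1\<close>.\<close>
  define v where "v = map (\<lambda>x. the (map_of (zip \<sigma> (zip (labels M) u)) x)) [1..<Suc ?n]"
  have len: "length v = ?n" by (simp add: v_def del: upt_Suc)
  have nth: "v ! (\<sigma> ! p - 1) = (labels M ! p, u ! p)" if "p < ?n" for p
  proof -
    have "v ! (\<sigma> ! p - 1) = the (map_of (zip \<sigma> (zip (labels M) u)) (\<sigma> ! p))"
      unfolding v_def using permutation_nth_bounds[OF D(1) that] by (simp del: upt_Suc)
    also have "map_of (zip \<sigma> (zip (labels M) u)) (\<sigma> ! p) = Some (zip (labels M) u ! p)"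
      using dist D(2,3) that by (intro map_of_zip_nth) auto
    finally show ?thesis using that D(3) by simp
  qed
  have map: "map (\<lambda>x. v ! (x - 1)) \<sigma> = zip (labels M) u"
    using D(2,3) nth by (intro nth_equalityI) auto
  have m: "mset v = M"
    using mset_reindex[of \<sigma> v, unfolded len, OF D(1)] D(4) unfolding map by simp
  have "\<sigma> = sorting v"
    unfolding sorting_iff
  proof
    show "\<sigma> \<in> permutations_of_set {1..length v}" using D(1) len by simp
    show "sorted_wrt (precedes v) \<sigma>"
      unfolding sorted_wrt_iff_nth_less
    proof (intro allI impI)
      fix p q assume pq: "p < q" "q < length \<sigma>"
      then have "labels M ! p \<le> labels M ! q"
        using sorted_nth_mono[OF sorted_labels] D(2) by (metis length_labels less_imp_le)
      then show "precedes v (\<sigma> ! p) (\<sigma> ! q)"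
        using pq D(2) D(5)[of p q] nth[of p] nth[of q] by (auto simp: le_less)
    qed
  qed
  moreover have "u = map (\<lambda>x. snd (v ! (x - 1))) \<sigma>"
    using D(2,3) nth by (intro nth_equalityI) auto
  ultimately show "\<exists>v\<in>permutations_of_multiset M. h = unshuffle v"
    using m h by (intro bexI[of _ v]) (auto simp: unshuffle_def permutations_of_multisetI)
qed

lemma S_prod_unshuffle: "S_prod M = (\<Sum>v\<in>permutations_of_multiset M. basis_elt (unshuffle v))"
  unfolding S_prod_def by (rule sum.reindex_bij_betw[OF bij_betw_unshuffle, symmetric])

text \<open>
  The common refinement of two block structures; for \<open>a < k\<close> the label \<open>b * k + a\<close> encodes the
  pair \<open>(b, a)\<close> in lexicographic order.
\<close>

definition refine :: "('c, 'b) monoid_scheme \<Rightarrow> nat \<Rightarrow> (nat \<times> 'c) \<times> (nat \<times> 'c) \<Rightarrow> nat \<times> 'c" where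
  "refine G k = (\<lambda>((a, c), (b, d)). (b * k + a, c \<otimes>\<^bsub>G\<^esub> d))"

text \<open>Raising \<open>b\<close> by one adds \<open>k\<close>, which outweighs any difference
  between remainders below \<open>k\<close>.\<close>

lemma lex_encode_less_iff:
  fixes a a' b b' k :: nat
  assumes "a < k" "a' < k"
  shows "b * k + a < b' * k + a' \<longleftrightarrow> b < b' \<or> b = b' \<and> a < a'"
proof -
  have *: "b * k + a < b' * k + a'" if "b < b'" "a < k" for a a' b b'
  proof -
    have "Suc b * k \<le> b' * k" using that by (intro mult_right_mono) auto
    then show ?thesis using that by simp
  qed
  show ?thesis
    using *[of b b' a a'] *[of b' b a' a] assms by (cases b b' rule: linorder_cases) auto
qed

text \<open>Composing the permutations sorts stably by the labels of \<open>v\<close> and then by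
  those of \<open>w\<close>, the latter dominating; this is one stable sort by the refined label.
  The second word must be read along \<open>sorting v\<close> because the second sort acts on
  positions of the first.\<close>

lemma wreath_mult_unshuffle:
  assumes len: "length w = length v" and k: "\<And>x. x \<in> set v \<Longrightarrow> fst x < k"
  shows "unshuffle v \<otimes>\<^bsub>wreath G n\<^esub> unshuffle (map (\<lambda>x. w ! (x - 1)) (sorting v)) =
    unshuffle (map (refine G k) (zip v w))"
proof -
  let ?w = "map (\<lambda>x. w ! (x - 1)) (sorting v)" and ?W = "map (refine G k) (zip v w)"
  let ?\<sigma> = "sorting v" let ?\<tau> = "sorting ?w" let ?n = "length v"
  let ?\<rho> = "map (\<lambda>j. ?\<sigma> ! (j - 1)) ?\<tau>"
  have \<sigma>: "?\<sigma> \<in> permutations_of_set {1..?n}" and \<tau>: "?\<tau> \<in> permutations_of_set {1..?n}"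
    using sorting_permutation[of v] sorting_permutation[of ?w] by simp_all
  have mset: "mset ?\<rho> = mset ?\<sigma>" using mset_reindex[of ?\<tau> ?\<sigma>] \<tau> by simp
  then have perm: "?\<rho> \<in> permutations_of_set {1..?n}"
    using \<sigma> unfolding permutations_of_set_def
    by (metis (mono_tags, lifting) mem_Collect_eq mset_eq_imp_distinct_iff mset_eq_setD)
  have lenW: "length ?W = ?n" using len by simp
  have W: "?W ! i = (fst (w ! i) * k + fst (v ! i), snd (v ! i) \<otimes>\<^bsub>G\<^esub> snd (w ! i))" if "i < ?n" for i
    using that len by (simp add: refine_def case_prod_unfold)
  have "?\<rho> = sorting ?W"
    unfolding sorting_iff
  proof
    show "?\<rho> \<in> permutations_of_set {1..length ?W}" using perm len by simp
    show "sorted_wrt (precedes ?W) ?\<rho>"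
      unfolding sorted_wrt_iff_nth_less
    proof (intro allI impI)
      fix p q assume pq: "p < q" "q < length ?\<rho>"
      define i j where "i = ?\<tau> ! p" and "j = ?\<tau> ! q"
      have i: "1 \<le> i" "i - 1 < ?n" and j: "1 \<le> j" "j - 1 < ?n"
        using pq permutation_nth_bounds[OF \<tau>] by (auto simp: i_def j_def)
      define x y where "x = ?\<sigma> ! (i - 1)" and "y = ?\<sigma> ! (j - 1)"
      have x: "x - 1 < ?n" and y: "y - 1 < ?n"
        using i j permutation_nth_bounds[OF \<sigma>] by (auto simp: x_def y_def)
      have "precedes ?w i j"
        using sorting_iff[of ?\<tau> ?w] pq by (auto simp: sorted_wrt_iff_nth_less i_def j_def)
      then have *: "fst (w ! (x - 1)) < fst (w ! (y - 1)) \<or>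
          fst (w ! (x - 1)) = fst (w ! (y - 1)) \<and> i < j"
        using i j by (simp add: x_def y_def)
      \<comment> \<open>\<open>i\<close> and \<open>j\<close> are positions in the first sorting and
        \<open>x\<close>, \<open>y\<close> the values there. A tie between labels of
        \<open>w\<close> leaves \<open>i < j\<close>, and the first sorting then decides by the
        labels of \<open>v\<close> and finally by value.\<close>
      have "precedes v x y" if "i < j"
      proof -
        have "i - 1 < j - 1" using that i by simp
        then show ?thesis
          using sorting_iff[of ?\<sigma> v] j unfolding sorted_wrt_iff_nth_less x_def y_def
          by (metis length_sorting)
      qed
      moreover have "fst (v ! (x - 1)) < k" "fst (v ! (y - 1)) < k"
        using k x y by (meson nth_mem)+
      moreover have "?\<rho> ! p = x" "?\<rho> ! q = y" using pq by (simp_all add: x_def y_def i_def j_def)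
      ultimately show "precedes ?W (?\<rho> ! p) (?\<rho> ! q)"
        using * x y W[of "x - 1"] W[of "y - 1"]
        by (auto simp: lex_encode_less_iff)
    qed
  qed
  \<comment> \<open>Both color factors at a position come from the same value \<open>x\<close> of
    the composed permutation: the left one from \<open>v\<close>, the right one from
    \<open>w\<close>.\<close>
  moreover have "map2 (\<lambda>j d. map (\<lambda>x. snd (v ! (x - 1))) ?\<sigma> ! (j - 1) \<otimes>\<^bsub>G\<^esub> d) ?\<tau>
      (map (\<lambda>x. snd (?w ! (x - 1))) ?\<tau>) = map (\<lambda>x. snd (?W ! (x - 1))) ?\<rho>"
  proof (rule nth_equalityI)
    fix p assume "p < length (map2 (\<lambda>j d. map (\<lambda>x. snd (v ! (x - 1))) ?\<sigma> ! (j - 1) \<otimes>\<^bsub>G\<^esub> d) ?\<tau>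
      (map (\<lambda>x. snd (?w ! (x - 1))) ?\<tau>))"
    then have p: "p < ?n" by simp
    then have "?\<tau> ! p - 1 < ?n" "?\<sigma> ! (?\<tau> ! p - 1) - 1 < ?n"
      using permutation_nth_bounds[OF \<tau>] permutation_nth_bounds[OF \<sigma>] by blast+
    then show "map2 (\<lambda>j d. map (\<lambda>x. snd (v ! (x - 1))) ?\<sigma> ! (j - 1) \<otimes>\<^bsub>G\<^esub> d) ?\<tau>
      (map (\<lambda>x. snd (?w ! (x - 1))) ?\<tau>) ! p = map (\<lambda>x. snd (?W ! (x - 1))) ?\<rho> ! p"
      using p W by simp
  qed simp
  ultimately show ?thesis
    by (simp add: unshuffle_def wreath_def)
qed

subsection \<open>Products in the wreath product\<close>

text \<open>A permutation of positions carrying \<open>V\<close> to \<open>V'\<close> commutes with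
  \<open>map r\<close>, so it maps the fibre over \<open>V\<close> injectively into the fibre over
  \<open>V'\<close>.\<close>

lemma card_fibre_rearrange_le:
  assumes fin: "finite X" and closed: "\<And>W W'. W \<in> X \<Longrightarrow> mset W' = mset W \<Longrightarrow> W' \<in> X"
    and V: "mset V = mset V'"
  shows "card {W \<in> X. map r W = V} \<le> card {W \<in> X. map r W = V'}"
proof -
  obtain \<pi> where \<pi>: "\<pi> permutes {..<length V}" "permute_list \<pi> V = V'"
    using mset_eq_permutation[OF V[symmetric]] by blast
  let ?F = "{W \<in> X. map r W = V}"
  have len: "length W = length V" if "W \<in> ?F" for W
    using that by (auto dest: arg_cong[of _ _ length])
  have "inj_on (permute_list \<pi>) ?F"
  proof (rule inj_on_inverseI)
    fix W assume W: "W \<in> ?F"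
    have "permute_list (inv_into UNIV \<pi>) (permute_list \<pi> W) =
        permute_list (\<pi> \<circ> inv_into UNIV \<pi>) W"
      using permutes_inv[OF \<pi>(1)] len[OF W] by (simp add: permute_list_compose)
    then show "permute_list (inv_into UNIV \<pi>) (permute_list \<pi> W) = W"
      using permutes_inv_o[OF \<pi>(1)] by simp
  qed
  moreover have "permute_list \<pi> ` ?F \<subseteq> {W \<in> X. map r W = V'}"
  proof clarify
    fix W assume W: "W \<in> X" "V = map r W"
    then have "\<pi> permutes {..<length W}" using \<pi>(1) by simp
    then show "permute_list \<pi> W \<in> X \<and> map r (permute_list \<pi> W) = V'"
      using closed[OF W(1)] \<pi>(2) W(2) by (simp add: permute_list_map)
  qed
  ultimately show ?thesis using fin by (intro card_inj_on_le) auto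
qed

text \<open>Group the sum by the multiset \<open>K\<close> of the image word. All rearrangements of
  \<open>K\<close> have fibres of equal size, so each group is an integer multiple of
  \<open>S_prod K\<close>.\<close>

lemma sum_rearrangements_in_span:
  assumes fin: "finite X" and closed: "\<And>W W'. W \<in> X \<Longrightarrow> mset W' = mset W \<Longrightarrow> W' \<in> X"
  shows "(\<Sum>W\<in>X. basis_elt (unshuffle (map r W))) \<in>
    scale.span (S_prod ` (\<lambda>W. mset (map r W)) ` X)"
proof -
  have "(\<Sum>W | W \<in> X \<and> mset (map r W) = K. basis_elt (unshuffle (map r W))) \<in>
      scale.span (S_prod ` (\<lambda>W. mset (map r W)) ` X)"
    if K: "K \<in> (\<lambda>W. mset (map r W)) ` X" for K
  proof -
    let ?P = "permutations_of_multiset K" and ?k = "\<lambda>V. card {W \<in> X. map r W = V}"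
    obtain V0 where V0: "mset V0 = K" using ex_mset by blast
    \<comment> \<open>Equality of the fibre sizes comes from the inequality applied in both
      directions.\<close>
    have k: "?k V = ?k V0" if "V \<in> ?P" for V
      using card_fibre_rearrange_le[OF fin closed, where V = V and V' = V0 and r = r]
        card_fibre_rearrange_le[OF fin closed, where V = V0 and V' = V and r = r] V0 permutations_of_multisetD[OF that]
      by (intro antisym) auto
    have const: "(\<Sum>x\<in>A. y) = scale (of_nat (card A)) y" for A :: "'d set" and y :: "'e \<Rightarrow>\<^sub>0 complex"
      by (induction A rule: infinite_finite_induct) (auto simp: scale.scale_left_distrib)
    have "(\<Sum>W | W \<in> X \<and> mset (map r W) = K. basis_elt (unshuffle (map r W))) =
        (\<Sum>V\<in>?P. \<Sum>W | W \<in> {W. W \<in> X \<and> mset (map r W) = K} \<and> map r W = V.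
          basis_elt (unshuffle (map r W)))"
      using fin by (intro sum.group[symmetric]) (auto intro: permutations_of_multisetI)
    also have "\<dots> = (\<Sum>V\<in>?P. \<Sum>W | W \<in> X \<and> map r W = V. basis_elt (unshuffle V))"
      by (intro sum.cong) (auto dest: permutations_of_multisetD)
    also have "\<dots> = (\<Sum>V\<in>?P. scale (of_nat (?k V0)) (basis_elt (unshuffle V)))"
      by (intro sum.cong refl) (simp add: const k)
    also have "\<dots> = scale (of_nat (?k V0)) (S_prod K)"
      by (simp add: S_prod_unshuffle scale.scale_sum_right)
    also have "\<dots> \<in> scale.span (S_prod ` (\<lambda>W. mset (map r W)) ` X)"
      using K by (intro scale.span_scale scale.span_base imageI)
    finally show ?thesis .
  qed
  then show ?thesis
    unfolding sum.image_gen[OF fin, of _ "\<lambda>W. mset (map r W)"] by (rule scale.span_sum)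
qed

text \<open>For fixed \<open>v\<close>, reading words along \<open>sorting v\<close> permutes the
  rearrangements of \<open>N\<close>, so the second factor can be reindexed into the form for which
  the product is known. Zipping then turns pairs of words into words of pairs with marginals
  \<open>M\<close> and \<open>N\<close>.\<close>

lemma wreath_mult_S_prod:
  assumes size: "size N = size M" and k: "\<And>x. x \<in># M \<Longrightarrow> fst x < k"
  shows "bilin (\<lambda>g h. basis_elt (g \<otimes>\<^bsub>wreath G n\<^esub> h)) (S_prod M) (S_prod N) =
    (\<Sum>W | mset (map fst W) = M \<and> mset (map snd W) = N.
      basis_elt (unshuffle (map (refine G k) W)))"
proof -
  let ?PM = "permutations_of_multiset M" and ?PN = "permutations_of_multiset N"
  have len: "length v = size M" if "v \<in> ?PM \<or> v \<in> ?PN" for v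
    using that size by (auto simp: length_finite_permutations_of_multiset)
  have "(\<Sum>h\<in>?PN. basis_elt (unshuffle v \<otimes>\<^bsub>wreath G n\<^esub> unshuffle h)) =
      (\<Sum>w\<in>?PN. basis_elt (unshuffle (map (refine G k) (zip v w))))" if v: "v \<in> ?PM" for v
  proof -
    let ?r = "\<lambda>w. map (\<lambda>x. w ! (x - 1)) (sorting v)"
    have s: "sorting v \<in> permutations_of_set {1..size M}"
      using sorting_permutation[of v] len v by simp
    \<comment> \<open>An injective self-map of a finite set is bijective, so no inverse reading is
      needed.\<close>
    have "inj_on ?r ?PN"
      using reindex_inj[OF s] len by (intro inj_onI) blast
    moreover have "?r ` ?PN \<subseteq> ?PN"
    proof clarify
      fix w assume w: "w \<in> ?PN"
      then have "mset (?r w) = mset w" using s len by (intro mset_reindex) simp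
      then show "?r w \<in> ?PN"
        using permutations_of_multisetD[OF w] by (intro permutations_of_multisetI) simp
    qed
    ultimately have "bij_betw ?r ?PN ?PN"
      by (simp add: bij_betw_def endo_inj_surj)
    then have "(\<Sum>h\<in>?PN. basis_elt (unshuffle v \<otimes>\<^bsub>wreath G n\<^esub> unshuffle h)) =
        (\<Sum>w\<in>?PN. basis_elt (unshuffle v \<otimes>\<^bsub>wreath G n\<^esub> unshuffle (?r w)))"
      by (rule sum.reindex_bij_betw[symmetric])
    also have "\<dots> = (\<Sum>w\<in>?PN. basis_elt (unshuffle (map (refine G k) (zip v w))))"
    proof (intro sum.cong refl)
      fix w assume "w \<in> ?PN"
      moreover have "fst x < k" if "x \<in> set v" for x
        using that permutations_of_multisetD[OF v] by (intro k) auto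
      ultimately show "basis_elt (unshuffle v \<otimes>\<^bsub>wreath G n\<^esub> unshuffle (?r w)) =
          basis_elt (unshuffle (map (refine G k) (zip v w)))"
        using v len by (subst wreath_mult_unshuffle) auto
    qed
    finally show ?thesis .
  qed
  then have "bilin (\<lambda>g h. basis_elt (g \<otimes>\<^bsub>wreath G n\<^esub> h)) (S_prod M) (S_prod N) =
      (\<Sum>v\<in>?PM. \<Sum>w\<in>?PN. basis_elt (unshuffle (map (refine G k) (zip v w))))"
    by (simp add: S_prod_unshuffle bilin_sum_left bilin_sum_right[where f = "basis_elt _"])
  also have "\<dots> = (\<Sum>(v, w)\<in>?PM \<times> ?PN. basis_elt (unshuffle (map (refine G k) (zip v w))))"
    by (rule sum.cartesian_product)
  also have "\<dots> = (\<Sum>W | mset (map fst W) = M \<and> mset (map snd W) = N.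
      basis_elt (unshuffle (map (refine G k) W)))"
  proof (rule sum.reindex_bij_witness[where i = "\<lambda>W. (map fst W, map snd W)" and
        j = "\<lambda>p. zip (fst p) (snd p)"])
    fix p assume p: "p \<in> ?PM \<times> ?PN"
    then have *: "length (fst p) = length (snd p)"
      using len[of "fst p"] len[of "snd p"] by (simp add: mem_Times_iff)
    then show "(map fst (zip (fst p) (snd p)), map snd (zip (fst p) (snd p))) = p" by simp
    have "mset (fst p) = M" "mset (snd p) = N"
      using p by (simp_all add: mem_Times_iff permutations_of_multisetD)
    then show "zip (fst p) (snd p) \<in> {W. mset (map fst W) = M \<and> mset (map snd W) = N}"
      using * by (simp del: mset_map)
    show "basis_elt (unshuffle (map (refine G k) (zip (fst p) (snd p)))) =
        (case p of (v, w) \<Rightarrow> basis_elt (unshuffle (map (refine G k) (zip v w))))"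
      by (simp add: case_prod_unfold)
  next
    fix W assume "W \<in> {W. mset (map fst W) = M \<and> mset (map snd W) = N}"
    then show "(map fst W, map snd W) \<in> ?PM \<times> ?PN"
      by (simp add: permutations_of_multiset_def)
  qed (simp add: zip_map_fst_snd)
  finally show ?thesis .
qed

lemma finite_rearrangements: "finite {W. mset (map fst W) = M \<and> mset (map snd W) = N}"
proof (rule finite_subset)
  show "{W. mset (map fst W) = M \<and> mset (map snd W) = N} \<subseteq>
      (\<lambda>(v, w). zip v w) ` (permutations_of_multiset M \<times> permutations_of_multiset N)"
  proof
    fix W assume "W \<in> {W. mset (map fst W) = M \<and> mset (map snd W) = N}"
    then have "(map fst W, map snd W) \<in> permutations_of_multiset M \<times> permutations_of_multiset N"
      by (simp add: permutations_of_multiset_def)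
    moreover have "W = (\<lambda>(v, w). zip v w) (map fst W, map snd W)"
      by (simp add: zip_map_fst_snd)
    ultimately show "W \<in> (\<lambda>(v, w). zip v w) `
        (permutations_of_multiset M \<times> permutations_of_multiset N)"
      by (rule rev_image_eqI)
  qed
qed auto

subsection \<open>The spanning set\<close>

text \<open>The degree set \<open>N\<close> lets one span serve for the whole algebra
  (\<open>UNIV\<close>) and for a single component (\<open>{n}\<close>).\<close>

definition S_span :: "'c set \<Rightarrow> nat set \<Rightarrow> ('c colored_perm \<Rightarrow>\<^sub>0 complex) set" where
  "S_span C N = scale.span (S_prod ` {M. snd ` set_mset M \<subseteq> C \<and> size M \<in> N})"

lemma subspace_S_span: "scale.subspace (S_span C N)"
  by (simp add: S_span_def)

lemma S_prod_in_S_span: "snd ` set_mset M \<subseteq> C \<Longrightarrow> size M \<in> N \<Longrightarrow> S_prod M \<in> S_span C N"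
  unfolding S_span_def by (rule scale.span_base) blast

lemma lookup_S_prod: "Poly_Mapping.lookup (S_prod M) h = (if h \<in> blocked M then 1 else 0)"
  by (auto simp: S_prod_def lookup_sum lookup_single when_def)

lemma keys_S_prod: "Poly_Mapping.keys (S_prod M) = blocked M"
  by (auto simp: in_keys_iff lookup_S_prod split: if_splits)

lemma label_bound: "\<exists>k::nat. \<forall>x. x \<in># M \<longrightarrow> fst x < k"
  using finite_nat_set_iff_bounded[THEN iffD1, of "fst ` set_mset M"] by fastforce

lemma S_span_subset:
  assumes "\<And>n. n \<in> N \<Longrightarrow> colored_perms_of_size C n \<subseteq> B"
  shows "S_span C N \<subseteq> {f. Poly_Mapping.keys f \<subseteq> B}"
  unfolding S_span_def
proof (rule scale.span_minimal[OF _ subspace_keys], clarify)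
  fix M :: "(nat \<times> 'a) multiset" and \<sigma> u
  assume M: "snd ` set_mset M \<subseteq> C" "size M \<in> N" "(\<sigma>, u) \<in> Poly_Mapping.keys (S_prod M)"
  then show "(\<sigma>, u) \<in> B"
    using blocked_subset[OF M(1)] assms[OF M(2)] by (auto simp: keys_S_prod)
qed

lemma S_prod_empty: "S_prod {#} = basis_elt ([], [])"
  unfolding S_prod_def using blocked_single_label[of 0 "{#} :: 'a multiset"] by simp

text \<open>The span is closed under the product because two spanning elements multiply to a single
  one once their labels are separated.\<close>

lemma S_span_subalgebra: "complex_subalgebra (S_span C UNIV) (FQSym C)"
  unfolding FQSym_def complex_subalgebra_iff
proof (intro conjI ballI)
  show "scale.subspace (S_span C UNIV)" by (rule subspace_S_span)
  show "S_span C UNIV \<subseteq> {f. Poly_Mapping.keys f \<subseteq> colored_perms C}"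
    by (rule S_span_subset) (auto simp: colored_perms_def)
  show "basis_elt ([], []) \<in> S_span C UNIV"
    using S_prod_in_S_span[of "{#}" C UNIV] by (simp add: S_prod_empty)
next
  fix f g assume fg: "f \<in> S_span C UNIV" "g \<in> S_span C UNIV"
  show "bilin (\<lambda>(\<sigma>', u') (\<sigma>'', u''). \<Sum>\<sigma>\<in>convolution \<sigma>' \<sigma>''. basis_elt (\<sigma>, u' @ u'')) f g
    \<in> S_span C UNIV"
  proof (rule bilin_span[OF subspace_S_span _ fg[unfolded S_span_def]], clarify)
    fix M N :: "(nat \<times> 'a) multiset"
    assume MN: "snd ` set_mset M \<subseteq> C" "snd ` set_mset N \<subseteq> C"
    \<comment> \<open>Shifting the labels of \<open>N\<close> by a strict upper bound for those of
      \<open>M\<close> places all its blocks after those of \<open>M\<close>.\<close>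
    obtain k where k: "\<And>x. x \<in># M \<Longrightarrow> fst x < k" using label_bound[of M] by blast
    let ?N = "image_mset (map_prod (\<lambda>a. a + k) id) N"
    have "S_prod N = S_prod ?N"
      by (simp add: S_prod_def blocked_relabel strict_mono_def)
    moreover have "bilin (\<lambda>(\<sigma>', u') (\<sigma>'', u''). \<Sum>\<sigma>\<in>convolution \<sigma>' \<sigma>''. basis_elt (\<sigma>, u' @ u''))
        (S_prod M) (S_prod ?N) = S_prod (M + ?N)"
    proof (rule S_prod_mult)
      fix x y assume "x \<in># M" "y \<in># ?N"
      then show "fst x < fst y" using k[of x] by auto
    qed
    moreover have "S_prod (M + ?N) \<in> S_span C UNIV"
      using MN by (intro S_prod_in_S_span) auto
    ultimately show "bilin (\<lambda>(\<sigma>', u') (\<sigma>'', u''). \<Sum>\<sigma>\<in>convolution \<sigma>' \<sigma>''. basis_elt (\<sigma>, u' @ u''))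
        (S_prod M) (S_prod N) \<in> S_span C UNIV" by metis
  qed
qed

text \<open>Induction on the label bound: the block with the greatest admissible label is split off
  as one generator on the right. If that block is empty, the factor is the generator of the zero
  vector.\<close>

lemma S_prod_in_subalgebra:
  assumes c: "inj_on c {..<l}" and V: "complex_subalgebra V (FQSym (c ` {..<l}))"
    and gen: "\<And>\<nn>. S_gen l c \<nn> \<in> V"
    and M: "snd ` set_mset M \<subseteq> c ` {..<l}" "\<And>x. x \<in># M \<Longrightarrow> fst x < k"
  shows "S_prod M \<in> V"
proof -
  have single: "S_prod (image_mset (Pair a) U) \<in> V" if "set_mset U \<subseteq> c ` {..<l}" for a U
    using S_gen_eq_S_prod[OF c that, of "\<lambda>i. count U (c i)" a] gen by metis
  show ?thesis
    using M
  proof (induction k arbitrary: M)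
    case 0
    then have "M = {#}" by (metis less_nat_zero_code multiset_nonemptyE)
    then show ?case using single[of "{#}" 0] by simp
  next
    case (Suc k)
    let ?L = "{#x \<in># M. fst x < k#}" and ?U = "image_mset snd {#x \<in># M. \<not> fst x < k#}"
    \<comment> \<open>Labels are below \<open>Suc k\<close>, so those not below \<open>k\<close>
      equal \<open>k\<close> and can be restored from the colors alone.\<close>
    have "image_mset (Pair k) ?U = image_mset (\<lambda>x. x) {#x \<in># M. \<not> fst x < k#}"
      unfolding multiset.map_comp using Suc.prems(2)
      by (intro image_mset_cong) (auto simp: less_Suc_eq prod_eq_iff)
    then have M: "M = ?L + image_mset (Pair k) ?U" by simp
    have "S_prod ?L \<in> V" using Suc.prems by (intro Suc.IH) auto
    moreover have "S_prod (image_mset (Pair k) ?U) \<in> V" using Suc.prems by (intro single) auto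
    ultimately have "bilin (\<lambda>(\<sigma>', u') (\<sigma>'', u''). \<Sum>\<sigma>\<in>convolution \<sigma>' \<sigma>''. basis_elt (\<sigma>, u' @ u''))
        (S_prod ?L) (S_prod (image_mset (Pair k) ?U)) \<in> V"
      using V unfolding FQSym_def complex_subalgebra_iff by blast
    then show ?case
      by (subst M, subst (asm) S_prod_mult) auto
  qed
qed

text \<open>The span is a subalgebra containing the generators, and every such subalgebra contains
  all their products.\<close>

lemma Sym_eq:
  assumes c: "inj_on c {..<l}"
  shows "Sym l c = S_span (c ` {..<l}) UNIV"
proof
  have "S_gen l c \<nn> \<in> S_span (c ` {..<l}) UNIV" for \<nn>
  proof -
    \<comment> \<open>The content realizing a given vector; injectivity of \<open>c\<close> keeps
      the multiplicities of different indices from adding up.\<close>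
    let ?U = "\<Sum>i<l. replicate_mset (\<nn> i) (c i)"
    have U: "set_mset ?U \<subseteq> c ` {..<l}" by (auto simp: set_mset_sum split: if_splits)
    have "count ?U (c i) = \<nn> i" if "i < l" for i
    proof -
      have "count ?U (c i) = (\<Sum>j<l. if j = i then \<nn> j else 0)"
        unfolding count_sum using that c by (intro sum.cong) (auto simp: inj_on_eq_iff)
      then show ?thesis using that by simp
    qed
    then have "S_gen l c \<nn> = S_prod (image_mset (Pair 0) ?U)"
      by (rule S_gen_eq_S_prod[OF c U])
    then show ?thesis
      using U by (auto intro!: S_prod_in_S_span)
  qed
  then show "Sym l c \<subseteq> S_span (c ` {..<l}) UNIV"
    unfolding Sym_def using S_span_subalgebra by blast
  show "S_span (c ` {..<l}) UNIV \<subseteq> Sym l c"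
    unfolding Sym_def
  proof (rule Inter_greatest, clarify)
    fix V f assume V: "complex_subalgebra V (FQSym (c ` {..<l}))" "\<forall>\<nn>. S_gen l c \<nn> \<in> V"
      and f: "f \<in> S_span (c ` {..<l}) UNIV"
    have "S_prod M \<in> V" if "snd ` set_mset M \<subseteq> c ` {..<l}" for M
      using S_prod_in_subalgebra[OF c V(1) V(2)[rule_format] that] label_bound by blast
    moreover have "scale.subspace V" using V(1) by (simp add: FQSym_def complex_subalgebra_iff)
    ultimately have "S_span (c ` {..<l}) UNIV \<subseteq> V"
      unfolding S_span_def by (intro scale.span_minimal) auto
    then show "f \<in> V" using f by blast
  qed
qed

text \<open>The projection \<open>\<pi>\<close> onto degree \<open>n\<close> is linear, fixes the
  spanning elements of size \<open>n\<close> and kills the others, so it maps into the smaller span;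
  it fixes \<open>f\<close> by the support condition.\<close>

lemma S_span_component:
  fixes C :: "'c set"
  assumes f: "f \<in> S_span C UNIV" and keys: "Poly_Mapping.keys f \<subseteq> colored_perms_of_size C n"
  shows "f \<in> S_span C {n}"
proof -
  define \<pi> :: "('c colored_perm \<Rightarrow>\<^sub>0 complex) \<Rightarrow> ('c colored_perm \<Rightarrow>\<^sub>0 complex)" where
    "\<pi> = Poly_Mapping.mapp (\<lambda>h a. if length (fst h) = n then a else 0)"
  have lookup: "Poly_Mapping.lookup (\<pi> g) h =
      (if length (fst h) = n then Poly_Mapping.lookup g h else 0)" for g h
    by (auto simp: \<pi>_def lookup_mapp when_def in_keys_iff)
  have "\<pi> f \<in> S_span C {n}"
  proof (rule scale.span_induct[OF f[unfolded S_span_def], of "\<lambda>f. \<pi> f \<in> S_span C {n}"])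
    have "\<pi> 0 = 0" "\<pi> (g + h) = \<pi> g + \<pi> h" "\<pi> (scale a g) = scale a (\<pi> g)" for g h a
      by (auto intro!: poly_mapping_eqI simp: lookup lookup_add)
    then show "scale.subspace {f. \<pi> f \<in> S_span C {n}}"
      using subspace_S_span[of C "{n}"] by (simp add: scale.subspace_def)
  next
    fix g assume "g \<in> S_prod ` {M. snd ` set_mset M \<subseteq> C \<and> size M \<in> UNIV}"
    then obtain M where M: "snd ` set_mset M \<subseteq> C" "g = S_prod M" by auto
    have len: "length (fst h) = size M" if "h \<in> blocked M" for h
      using blockedD(2)[of "fst h" "snd h"] that by simp
    show "\<pi> g \<in> S_span C {n}"
    proof (cases "size M = n")
      case True
      then have "\<pi> g = S_prod M"
        using len by (auto intro!: poly_mapping_eqI simp: lookup lookup_S_prod M(2))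
      then show ?thesis using S_prod_in_S_span[OF M(1)] True by simp
    next
      case False
      then have "\<pi> g = 0"
        using len by (auto intro!: poly_mapping_eqI simp: lookup lookup_S_prod M(2))
      then show ?thesis using scale.subspace_0[OF subspace_S_span] by simp
    qed
  qed
  moreover have "\<pi> f = f"
    using keys by (intro poly_mapping_eqI)
      (force simp: lookup in_keys_iff colored_perms_of_size_def permutations_of_set_length)
  ultimately show ?thesis by simp
qed

section \<open>Homogeneous components inside the group algebra\<close>

lemma Sym_component_eq:
  assumes "inj_on c {..<l}"
  shows "Sym_component l c n = S_span (c ` {..<l}) {n}"
proof
  show "Sym_component l c n \<subseteq> S_span (c ` {..<l}) {n}"
    using S_span_component by (auto simp: Sym_component_def Sym_eq[OF assms])
  have "S_span (c ` {..<l}) {n} \<subseteq> S_span (c ` {..<l}) UNIV"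
    unfolding S_span_def by (intro scale.span_mono) auto
  moreover have "S_span (c ` {..<l}) {n} \<subseteq>
      {f. Poly_Mapping.keys f \<subseteq> colored_perms_of_size (c ` {..<l}) n}"
    by (rule S_span_subset) auto
  ultimately show "S_span (c ` {..<l}) {n} \<subseteq> Sym_component l c n"
    by (auto simp: Sym_component_def Sym_eq[OF assms])
qed

lemma S_span_wreath_mult:
  assumes "group G" and f: "f \<in> S_span (carrier G) {n}" and g: "g \<in> S_span (carrier G) {n}"
  shows "bilin (\<lambda>x y. basis_elt (x \<otimes>\<^bsub>wreath G n\<^esub> y)) f g \<in> S_span (carrier G) {n}"
proof (rule bilin_span[OF subspace_S_span _ f[unfolded S_span_def] g[unfolded S_span_def]])
  interpret group G by fact
  fix f' g'
  assume "f' \<in> S_prod ` {M. snd ` set_mset M \<subseteq> carrier G \<and> size M \<in> {n}}"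
    "g' \<in> S_prod ` {M. snd ` set_mset M \<subseteq> carrier G \<and> size M \<in> {n}}"
  then obtain M N where fg: "f' = S_prod M" "g' = S_prod N"
    and MN: "snd ` set_mset M \<subseteq> carrier G" "snd ` set_mset N \<subseteq> carrier G"
    and size: "size M = n" "size N = n" by blast
  obtain k where k: "\<And>x. x \<in># M \<Longrightarrow> fst x < k" using label_bound[of M] by blast
  let ?X = "{W. mset (map fst W) = M \<and> mset (map snd W) = N}"
  have "bilin (\<lambda>x y. basis_elt (x \<otimes>\<^bsub>wreath G n\<^esub> y)) (S_prod M) (S_prod N) =
      (\<Sum>W\<in>?X. basis_elt (unshuffle (map (refine G k) W)))"
    using size k by (intro wreath_mult_S_prod) auto
  \<comment> \<open>The marginals depend only on the multiset of letters of a word, so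
    \<open>?X\<close> is closed under rearrangement.\<close>
  also have "\<dots> \<in> scale.span (S_prod ` (\<lambda>W. mset (map (refine G k) W)) ` ?X)"
    by (intro sum_rearrangements_in_span finite_rearrangements) simp
  also have "\<dots> \<subseteq> S_span (carrier G) {n}"
    unfolding S_span_def
  proof (intro scale.span_mono image_mono subsetI)
    fix K assume "K \<in> (\<lambda>W. mset (map (refine G k) W)) ` ?X"
    then obtain W where K: "K = mset (map (refine G k) W)"
      and W: "mset (map fst W) = M" "mset (map snd W) = N" by auto
    have "length W = n" using W(1) size(1) by (metis length_map size_mset)
    moreover have "snd (refine G k x) \<in> carrier G" if "x \<in> set W" for x
    proof -
      have "fst x \<in># M" "snd x \<in># N" using W that by auto
      then show ?thesis using MN by (force simp: refine_def case_prod_unfold)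
    qed
    ultimately show "K \<in> {M. snd ` set_mset M \<subseteq> carrier G \<and> size M \<in> {n}}"
      by (auto simp: K)
  qed
  finally show "bilin (\<lambda>x y. basis_elt (x \<otimes>\<^bsub>wreath G n\<^esub> y)) f' g' \<in> S_span (carrier G) {n}"
    unfolding fg .
qed

text \<open>The unit is a single generator: one block with \<open>n\<close> copies of the neutral
  color, which can be arranged in only one way.\<close>

lemma one_wreath_in_S_span:
  assumes "group G"
  shows "basis_elt \<one>\<^bsub>wreath G n\<^esub> \<in> S_span (carrier G) {n}"
proof -
  interpret group G by fact
  let ?U = "replicate_mset n \<one>\<^bsub>G\<^esub>"
  have "u = replicate n \<one>\<^bsub>G\<^esub>" if u: "mset u = ?U" for u
  proof (rule replicate_eqI)
    show "length u = n" using arg_cong[OF u, of size] by simp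
    show "x = \<one>\<^bsub>G\<^esub>" if "x \<in> set u" for x
      using that arg_cong[OF u, of set_mset] by (auto split: if_splits)
  qed
  then have "{u. mset u = ?U} = {replicate n \<one>\<^bsub>G\<^esub>}" by auto
  then have "S_prod (image_mset (Pair 0) ?U) = basis_elt \<one>\<^bsub>wreath G n\<^esub>"
    unfolding S_prod_def blocked_single_label by (simp add: wreath_def del: upt_Suc)
  moreover have "S_prod (image_mset (Pair 0) ?U) \<in> S_span (carrier G) {n}"
    by (rule S_prod_in_S_span) auto
  ultimately show ?thesis by simp
qed

theorem theorem3p2:
  fixes G :: "('c, 'b) monoid_scheme" and c :: "nat \<Rightarrow> 'c" and l n :: nat
  assumes "l \<ge> 1"
    and "inj_on c {..<l}"
    and "group G"
    and "carrier G = c ` {..<l}"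
  shows "complex_subalgebra (to_group_algebra ` Sym_component l c n)
           (group_algebra (wreath G n))"
proof -
  have "to_group_algebra ` Sym_component l c n = S_span (carrier G) {n}"
    using Sym_component_eq[OF assms(2)] assms(4) by (simp add: to_group_algebra_eq)
  moreover have "S_span (carrier G) {n} \<subseteq> {f. Poly_Mapping.keys f \<subseteq> carrier (wreath G n)}"
    by (rule S_span_subset) (simp add: wreath_def)
  ultimately show ?thesis
    using subspace_S_span one_wreath_in_S_span[OF assms(3)] S_span_wreath_mult[OF assms(3)]
    by (simp add: group_algebra_def complex_subalgebra_iff)
qed

end
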